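(* Let $D$ be a finite set with $|D|\ge 2$, let $\mathbb{P}_0=(p_{0s})_{s\in D}$ be a probability measure on $D$ with $p_{0s}>0$ for all $s$, and let $c\ge 1$ satisfy $c<\min_{s\in D}\frac{1}{1-p_{0s}}$. Let there be a single risky asset ($K=1$) with non-constant payoff $S:D\to\mathbb{R}$. Let $\alpha\in[0,1/2)$ and let $u$ be a strictly increasing, strictly concave, twice differentiable utility function satisfying the Inada conditions. Then: (i) For $\pi\ge\overline\pi$, $\operatorname{arg\,max}_{\theta\in\Theta,\,\theta\ge 0}V_\alpha(\theta)=0$. (ii) For $\pi\le\underline\pi$, $\operatorname{arg\,max}_{\theta\in\Theta,\,\theta\le 0}V_\alpha(\theta)=0$. (iii) For $\pi\in[\mathbb{E}_0[S],\overline\pi)$, there exists at least one negative and one positive locally optimal finite demand. (iv) For $\pi\in(\underline\pi,\mathbb{E}_0[S]]$, there exists at least one positive and one negative locally optimal finite demand.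
   Context: With initial wealth $w_0$ and price $\pi$, $W^\theta=w_0+\theta(S-\pi)$ and $$V_\alpha(\theta)=\alpha\min_{P\in\mathcal{X}}\mathbb{E}_P[u(W^\theta)]+(1-\alpha)\max_{P\in\mathcal{X}}\mathbb{E}_P[u(W^\theta)],$$ where $\mathcal{X}=\{P: P(s)\ge 0\ \forall s\in D,\ \sum_{s}P(s)=1,\ \sum_{s}P(s)^2/p_{0s}\le c\}$. Write $\mathbb{E}_0,\mathbb{S}_0$ for expectation and standard deviation under $\mathbb{P}_0$, $\delta=\sqrt{c-1}\,(2\alpha-1)$, and $$\overline\pi=\mathbb{E}_0[S]+|\delta|\,\mathbb{S}_0[S],\qquad \underline\pi=\mathbb{E}_0[S]-|\delta|\,\mathbb{S}_0[S].$$ A locally optimal demand is a local maximizer of $V_\alpha$ on the admissible set $\Theta$. Two cases are considered. (1) $u$ is defined on all of $\mathbb{R}$ and the admissible set is $\Theta=\mathbb{R}$. (2) $u$ is defined only for positive wealth, $w_0>0$ and $\Theta=\{\theta\in\mathbb{R}: w_0+\theta(S_s-\pi)>0\ \forall s\in D\}$. Inada conditions: $\lim_{x\downarrow-\infty}u'(x)=+\infty$ in case (1), $\lim_{x\downarrow0}u'(x)=+\infty$ in case (2), and $\lim_{x\uparrow+\infty}u'(x)=0$ in both cases. *)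

theory Defs
  imports "HOL-Probability.Probability"
begin

definition strictly_concave_on :: "real set \<Rightarrow> (real \<Rightarrow> real) \<Rightarrow> bool" where
  "strictly_concave_on I u \<longleftrightarrow>
     (\<forall>x\<in>I. \<forall>y\<in>I. \<forall>t\<in>{0<..<1}. x \<noteq> y \<longrightarrow>
        t * u x + (1 - t) * u y < u (t * x + (1 - t) * y))"

(* A utility function is a total function of which only the values on its domain I matter.
   I is an open interval, so "at x within I" in differentiable_on agrees with "at x", and
   deriv u is the derivative of u throughout I. *)
definition twice_differentiable_on :: "(real \<Rightarrow> real) \<Rightarrow> real set \<Rightarrow> bool" where
  "twice_differentiable_on u I \<longleftrightarrow> u differentiable_on I \<and> deriv u differentiable_on I"

definition inada_real_line :: "(real \<Rightarrow> real) \<Rightarrow> bool" where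
  "inada_real_line u \<longleftrightarrow> filterlim (deriv u) at_top at_bot \<and> (deriv u \<longlongrightarrow> 0) at_top"

definition inada_positive :: "(real \<Rightarrow> real) \<Rightarrow> bool" where
  "inada_positive u \<longleftrightarrow> filterlim (deriv u) at_top (at_right 0) \<and> (deriv u \<longlongrightarrow> 0) at_top"

definition wealth :: "real \<Rightarrow> real \<Rightarrow> ('d \<Rightarrow> real) \<Rightarrow> real \<Rightarrow> 'd \<Rightarrow> real" where
  "wealth w0 price S \<theta> s = w0 + \<theta> * (S s - price)"

(* For I = UNIV this is the whole real line; for I = {0<..} it is the set of demands with
   positive wealth in every state. *)
definition admissible :: "'d set \<Rightarrow> real set \<Rightarrow> real \<Rightarrow> real \<Rightarrow> ('d \<Rightarrow> real) \<Rightarrow> real set" where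
  "admissible D I w0 price S = {\<theta>. \<forall>s\<in>D. wealth w0 price S \<theta> s \<in> I}"

(* The probability measures on D: mass functions of type 'd pmf that are supported in D. *)
definition priors :: "'d set \<Rightarrow> 'd pmf \<Rightarrow> real \<Rightarrow> 'd pmf set" where
  "priors D P0 c = {P. set_pmf P \<subseteq> D \<and> (\<Sum>s\<in>D. (pmf P s)\<^sup>2 / pmf P0 s) \<le> c}"

definition expected_utility ::
    "(real \<Rightarrow> real) \<Rightarrow> real \<Rightarrow> real \<Rightarrow> ('d \<Rightarrow> real) \<Rightarrow> real \<Rightarrow> 'd pmf \<Rightarrow> real" where
  "expected_utility u w0 price S \<theta> P =
     measure_pmf.expectation P (\<lambda>s. u (wealth w0 price S \<theta> s))"

(* LEAST and GREATEST denote the minimum and the maximum, not merely infimum and supremum. *)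
definition V :: "'d set \<Rightarrow> 'd pmf \<Rightarrow> real \<Rightarrow> (real \<Rightarrow> real) \<Rightarrow> real \<Rightarrow> real \<Rightarrow>
    ('d \<Rightarrow> real) \<Rightarrow> real \<Rightarrow> real \<Rightarrow> real" where
  "V D P0 c u w0 price S \<alpha> \<theta> =
     \<alpha> * (LEAST v. v \<in> expected_utility u w0 price S \<theta> ` priors D P0 c)
     + (1 - \<alpha>) * (GREATEST v. v \<in> expected_utility u w0 price S \<theta> ` priors D P0 c)"

definition std_dev :: "'d pmf \<Rightarrow> ('d \<Rightarrow> real) \<Rightarrow> real" where
  "std_dev P X = sqrt (measure_pmf.variance P X)"

definition delta :: "real \<Rightarrow> real \<Rightarrow> real" where
  "delta c \<alpha> = sqrt (c - 1) * (2 * \<alpha> - 1)"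

definition upper_price :: "'d pmf \<Rightarrow> real \<Rightarrow> real \<Rightarrow> ('d \<Rightarrow> real) \<Rightarrow> real" where
  "upper_price P0 c \<alpha> S = measure_pmf.expectation P0 S + \<bar>delta c \<alpha>\<bar> * std_dev P0 S"

definition lower_price :: "'d pmf \<Rightarrow> real \<Rightarrow> real \<Rightarrow> ('d \<Rightarrow> real) \<Rightarrow> real" where
  "lower_price P0 c \<alpha> S = measure_pmf.expectation P0 S - \<bar>delta c \<alpha>\<bar> * std_dev P0 S"

definition local_maximizer_on :: "real set \<Rightarrow> (real \<Rightarrow> real) \<Rightarrow> real \<Rightarrow> bool" where
  "local_maximizer_on A f x \<longleftrightarrow>
     x \<in> A \<and> (\<exists>\<epsilon>>0. \<forall>y\<in>A. \<bar>y - x\<bar> < \<epsilon> \<longrightarrow> f y \<le> f x)"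

end

theory Submission imports Defs begin

(* A prior in the chi-square ball has the form q = p (1 + h) with E0[h] = 0 and E0[h^2] <= c - 1.
   The bound on c keeps the whole ball at a positive distance from the boundary of the simplex,
   so positivity never binds and, by Cauchy-Schwarz, the extreme values of E_q[X] are
   E0[X] - r sd(X) and E0[X] + r sd(X) with r = sqrt (c - 1). Hence V(theta) is E0[X] + |delta| sd(X)
   for X = u(W), which is the maximum of E_q[u(W)] over the ball of radius |delta|. The no-trade
   statements follow from the tangent of u at w0. For prices strictly between the two bounds, V
   increases at 0 in both directions, since some q in the ball gives S - price a positive mean and
   another one a negative mean. Far out, a state with falling wealth has weight bounded below and,
   by the Inada condition, arbitrarily large marginal utility, so V eventually decreases and its
   maximum on a half-line is interior. Negative demands are positive ones for (-S, -price). *)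

section \<open>Utility functions\<close>

text \<open>An open, upward closed \<open>I\<close> covers the real line and the positive half-line
  at once, so the two cases of the theorem need no separate treatment.\<close>

locale utility_function =
  fixes I :: "real set" and u :: "real \<Rightarrow> real"
  assumes open_I: "open I"
    and upward_closed: "x \<in> I \<Longrightarrow> x \<le> y \<Longrightarrow> y \<in> I"
    and increasing: "strict_mono_on I u"
    and strictly_concave: "strictly_concave_on I u"
    and differentiable: "u differentiable_on I"
begin

lemma has_derivative_deriv: "x \<in> I \<Longrightarrow> (u has_real_derivative deriv u x) (at x)"
  using differentiable open_I
  by (simp add: DERIV_deriv_iff_real_differentiable differentiable_on_def at_within_open[of _ I])

text \<open>The function \<open>- u\<close> is convex, so it lies above its tangents.\<close>

lemma tangent_le:
  assumes "x \<in> I" "y \<in> I"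
  shows "u x \<le> u y + deriv u y * (x - y)"
proof -
  have "is_interval I"
    using upward_closed by (auto simp: is_interval_1)
  then have I: "convex I"
    by (rule is_interval_convex)
  have "convex_on I (\<lambda>x. - u x)"
  proof (rule convex_onI[OF _ I])
    fix t x y :: real assume *: "0 < t" "t < 1" "x \<in> I" "y \<in> I"
    show "- u ((1 - t) *\<^sub>R x + t *\<^sub>R y) \<le> (1 - t) * - u x + t * - u y"
    proof (cases "x = y")
      case True
      then show ?thesis by (simp add: algebra_simps)
    next
      case False
      then have "t * u y + (1 - t) * u x < u (t * y + (1 - t) * x)"
        using strictly_concave * unfolding strictly_concave_on_def by auto
      then show ?thesis by (simp add: algebra_simps)
    qed
  qed
  then have "(- u x) - (- u y) \<ge> (- deriv u y) * (x - y)"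
    by (intro convex_on_imp_above_tangent[where A = I])
      (use assms I open_I has_derivative_deriv in
        \<open>auto intro!: derivative_intros simp: convex_connected interior_open at_within_open[of _ I]\<close>)
  then show ?thesis by simp
qed

text \<open>At the midpoint \<open>m\<close>, strict concavity puts \<open>u m\<close> above the
  chord while \<open>tangent_le\<close> keeps it below the tangent at \<open>y\<close>; comparing
  the two makes the bound at \<open>x\<close> strict.\<close>

lemma tangent_less:
  assumes "x \<in> I" "y \<in> I" "x \<noteq> y"
  shows "u x < u y + deriv u y * (x - y)"
proof -
  define m where "m = (1/2) * x + (1 - 1/2) * y"
  have "(1/2) * u x + (1 - 1/2) * u y < u m"
    unfolding m_def
    by (rule strictly_concave[unfolded strictly_concave_on_def, rule_format]) (use assms in auto)
  moreover have "m \<in> I"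
    using assms upward_closed[of "min x y" m] by (simp add: m_def min_def split: if_splits)
  then have "u m \<le> u y + deriv u y * (m - y)"
    using tangent_le assms by blast
  moreover have "m - y = (x - y) / 2"
    by (simp add: m_def field_simps)
  ultimately show ?thesis by (simp add: field_simps)
qed

text \<open>Monotonicity alone would only give a nonnegative derivative. Strictness comes from the
  tangent at \<open>x\<close>, which exceeds \<open>u (x + 1) > u x\<close>.\<close>

lemma deriv_pos:
  assumes "x \<in> I"
  shows "0 < deriv u x"
proof -
  have "x + 1 \<in> I" using upward_closed[OF assms, of "x + 1"] by simp
  moreover from this have "u x < u (x + 1)"
    using increasing assms by (auto simp: strict_mono_on_def)
  ultimately show ?thesis using tangent_less[of "x + 1" x] assms by auto
qed

text \<open>Adding the tangent inequalities at \<open>x\<close> and at \<open>y\<close> cancels the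
  values of \<open>u\<close>.\<close>

lemma deriv_antimono:
  assumes "x \<in> I" "x \<le> y"
  shows "deriv u y \<le> deriv u x"
proof (cases "x = y")
  case False
  have "y \<in> I" using upward_closed assms by blast
  then have "0 \<le> (deriv u x - deriv u y) * (y - x)"
    using tangent_le[of x y] tangent_le[of y x] assms by (simp add: algebra_simps)
  then show ?thesis using False assms by (simp add: zero_le_mult_iff)
qed simp

lemma continuous_on_u: "continuous_on I u"
  using differentiable by (rule differentiable_imp_continuous_on)

end

section \<open>Demand under a family of weights\<close>

text \<open>The last two assumptions say that \<open>F\<close> is the maximum over \<open>Q\<close>
  of weighted utilities. A maximizing \<open>q\<close> bounds \<open>F\<close> from above at its own
  demand, and any fixed \<open>q\<close> bounds \<open>F\<close> from below everywhere. The uniform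
  bound \<open>\<epsilon>\<close> prevents a losing state from being ignored.\<close>

locale robust_demand = utility_function I u for I u +
  fixes D :: "'d set" and Q :: "('d \<Rightarrow> real) set" and S :: "'d \<Rightarrow> real"
    and \<epsilon> price w0 :: real and F :: "real \<Rightarrow> real"
  assumes finite_D: "finite D"
    and \<epsilon>_pos: "0 < \<epsilon>"
    and weight_ge: "q \<in> Q \<Longrightarrow> s \<in> D \<Longrightarrow> \<epsilon> \<le> q s"
    and weight_sum: "q \<in> Q \<Longrightarrow> sum q D = 1"
    and w0_in: "w0 \<in> I"
    and F_ge: "\<theta> \<in> admissible D I w0 price S \<Longrightarrow> q \<in> Q \<Longrightarrow>
      (\<Sum>s\<in>D. q s * u (wealth w0 price S \<theta> s)) \<le> F \<theta>"
    and F_attained: "\<theta> \<in> admissible D I w0 price S \<Longrightarrow>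
      \<exists>q\<in>Q. F \<theta> = (\<Sum>s\<in>D. q s * u (wealth w0 price S \<theta> s))"
begin

abbreviation "A \<equiv> admissible D I w0 price S"
abbreviation "W \<equiv> wealth w0 price S"

lemma wealth_in: "\<theta> \<in> A \<Longrightarrow> s \<in> D \<Longrightarrow> W \<theta> s \<in> I"
  by (simp add: admissible_def)

lemma zero_admissible: "0 \<in> A"
  using w0_in by (simp add: admissible_def wealth_def)

lemma F_zero: "F 0 = u w0"
  using F_attained[OF zero_admissible] weight_sum by (auto simp: wealth_def simp flip: sum_distrib_right)

lemma weight_pos: "q \<in> Q \<Longrightarrow> s \<in> D \<Longrightarrow> 0 < q s"
  using weight_ge[of q s] \<epsilon>_pos by simp

lemma weight_le_1: "q \<in> Q \<Longrightarrow> s \<in> D \<Longrightarrow> q s \<le> 1"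
  using member_le_sum[of s D q] weight_sum[of q] weight_pos[of q] finite_D by (force simp: less_imp_le)

text \<open>Where the payoff is at least the price, wealth stays above \<open>w0\<close>; elsewhere
  it stays above its value at \<open>\<theta>1\<close>. Either way it remains in the upward closed
  \<open>I\<close>.\<close>

lemma admissible_down:
  assumes "\<theta>1 \<in> A" "0 \<le> \<theta>" "\<theta> \<le> \<theta>1"
  shows "\<theta> \<in> A"
proof -
  have "W \<theta> s \<in> I" if "s \<in> D" for s
  proof (cases "price \<le> S s")
    case True
    then show ?thesis using upward_closed[OF w0_in, of "W \<theta> s"] assms by (simp add: wealth_def)
  next
    case False
    then have "W \<theta>1 s \<le> W \<theta> s" using assms by (simp add: wealth_def mult_right_mono_neg)
    then show ?thesis using upward_closed wealth_in assms(1) that by blast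
  qed
  then show ?thesis by (simp add: admissible_def)
qed

text \<open>The tangent of \<open>u\<close> at \<open>w0\<close> replaces utility by an affine
  function of wealth, whose mean under every weight is at most \<open>u w0\<close> at these
  prices.\<close>

lemma F_less_initial:
  assumes \<theta>: "\<theta> \<in> A" "0 < \<theta>"
    and price: "\<And>q. q \<in> Q \<Longrightarrow> (\<Sum>s\<in>D. q s * S s) \<le> price"
    and "t \<in> D" "S t \<noteq> price"
  shows "F \<theta> < F 0"
proof -
  obtain q where q: "q \<in> Q" "F \<theta> = (\<Sum>s\<in>D. q s * u (W \<theta> s))"
    using F_attained \<theta> by blast
  have "(\<Sum>s\<in>D. q s * u (W \<theta> s)) < (\<Sum>s\<in>D. q s * (u w0 + deriv u w0 * (W \<theta> s - w0)))"
  proof (rule sum_strict_mono_ex1[OF finite_D])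
    show "\<forall>s\<in>D. q s * u (W \<theta> s) \<le> q s * (u w0 + deriv u w0 * (W \<theta> s - w0))"
      using q \<theta> by (auto intro!: mult_left_mono tangent_le wealth_in w0_in simp: less_imp_le weight_pos)
    \<comment> \<open>Wealth really moves in state \<open>t\<close>, so one summand is strict, and
      its weight is positive.\<close>
    have "u (W \<theta> t) < u w0 + deriv u w0 * (W \<theta> t - w0)"
      using \<theta> assms(4,5) by (intro tangent_less wealth_in w0_in) (auto simp: wealth_def)
    then show "\<exists>s\<in>D. q s * u (W \<theta> s) < q s * (u w0 + deriv u w0 * (W \<theta> s - w0))"
      using assms(4) weight_pos[OF q(1) assms(4)] by (auto intro!: bexI[of _ t])
  qed
  also have "\<dots> = (\<Sum>s\<in>D. q s * u w0 + deriv u w0 * \<theta> * (q s * S s) - deriv u w0 * \<theta> * price * q s)"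
    by (intro sum.cong refl) (simp add: wealth_def algebra_simps)
  also have "\<dots> = u w0 + deriv u w0 * \<theta> * ((\<Sum>s\<in>D. q s * S s) - price)"
    using weight_sum[OF q(1)]
    by (simp add: sum.distrib sum_subtractf right_diff_distrib
        flip: sum_distrib_left sum_distrib_right)
  also have "\<dots> \<le> u w0"
    using price[OF q(1)] \<theta> deriv_pos[OF w0_in] by (simp add: mult_nonneg_nonpos)
  finally show ?thesis by (simp add: q F_zero)
qed

text \<open>For the fixed weight \<open>q\<close>, the expected utility \<open>g\<close> lies below
  \<open>F\<close> on the admissible set, agrees with it at 0 and has there the positive slope
  \<open>deriv u w0\<close> times the mean excess payoff.\<close>

lemma F_greater_initial:
  assumes q: "q \<in> Q" and price: "price < (\<Sum>s\<in>D. q s * S s)" and b: "b \<in> A" "0 < b"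
  obtains \<theta> where "0 < \<theta>" "\<theta> < b" "F 0 < F \<theta>"
proof -
  define g where "g \<theta> = (\<Sum>s\<in>D. q s * u (W \<theta> s))" for \<theta>
  have "((\<lambda>\<theta>. u (w0 + \<theta> * (S s - price))) has_real_derivative deriv u w0 * (S s - price)) (at 0)" for s
    by (rule DERIV_chain2[where g = "\<lambda>\<theta>. w0 + \<theta> * (S s - price)"])
      (auto intro!: derivative_eq_intros simp: has_derivative_deriv w0_in)
  then have "(g has_real_derivative (\<Sum>s\<in>D. q s * (deriv u w0 * (S s - price)))) (at 0)"
    unfolding g_def wealth_def by (intro DERIV_sum DERIV_cmult)
  moreover have "(\<Sum>s\<in>D. q s * (deriv u w0 * (S s - price))) =
      deriv u w0 * ((\<Sum>s\<in>D. q s * S s) - price)"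
  proof -
    have "(\<Sum>s\<in>D. q s * (deriv u w0 * (S s - price))) =
        (\<Sum>s\<in>D. deriv u w0 * (q s * S s) - deriv u w0 * price * q s)"
      by (intro sum.cong refl) (simp add: algebra_simps)
    then show ?thesis
      using weight_sum[OF q] by (simp add: sum_subtractf right_diff_distrib flip: sum_distrib_left)
  qed
  ultimately obtain d where d: "0 < d" "\<And>h. 0 < h \<Longrightarrow> h < d \<Longrightarrow> g 0 < g h"
    using DERIV_pos_inc_right[of g "deriv u w0 * ((\<Sum>s\<in>D. q s * S s) - price)" 0]
      price deriv_pos[OF w0_in] by auto
  define \<theta> where "\<theta> = min d b / 2"
  have \<theta>: "0 < \<theta>" "\<theta> < d" "\<theta> < b" using d b by (auto simp: \<theta>_def)
  have "F 0 = g 0"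
    using weight_sum[OF q] by (simp add: F_zero g_def wealth_def flip: sum_distrib_right)
  also have "\<dots> < g \<theta>" using d \<theta> by simp
  also have "\<dots> \<le> F \<theta>"
    unfolding g_def using \<theta> by (intro F_ge q admissible_down[OF b(1)]) auto
  finally show ?thesis using that \<theta> by blast
qed

text \<open>Past \<open>b\<close>, the marginal loss in the worst state \<open>t\<close> outweighs
  all possible marginal gains, whichever weight is the maximizing one.\<close>

lemma F_eventually_decreasing:
  assumes steep: "\<And>K. \<exists>z\<in>I. z < w0 \<and> K < deriv u z"
    and t: "t \<in> D" "S t < price" "\<And>s. s \<in> D \<Longrightarrow> S t \<le> S s"
  obtains b where "b \<in> A" "0 < b" "\<And>\<theta>. \<theta> \<in> A \<Longrightarrow> b \<le> \<theta> \<Longrightarrow> F \<theta> \<le> F b"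
proof -
  define d where "d = price - S t"
  define M where "M = (\<Sum>s\<in>D. \<bar>S s - price\<bar>)"
  have d: "0 < d" using t by (simp add: d_def)
  \<comment> \<open>The number \<open>deriv u w0 * M\<close> will bound the total marginal gain in
    the other states, and \<open>\<epsilon> * d * deriv u z\<close> is the least marginal loss in
    state \<open>t\<close>.\<close>
  obtain z where z: "z \<in> I" "z < w0" "deriv u w0 * M / (\<epsilon> * d) < deriv u z"
    using steep by blast
  \<comment> \<open>This demand brings wealth in state \<open>t\<close> down to exactly
    \<open>z\<close>, which is then the lowest wealth over all states.\<close>
  define b where "b = (w0 - z) / d"
  have b: "0 < b" "b * d = w0 - z" using z d by (auto simp: b_def)
  have W_t: "W b t = z" using b by (simp add: wealth_def d_def algebra_simps)
  have "W b t \<le> W b s" if "s \<in> D" for s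
    using t(3)[OF that] b by (simp add: wealth_def)
  then have b_A: "b \<in> A"
    using z upward_closed W_t unfolding admissible_def by auto
  have "F \<theta> \<le> F b" if \<theta>: "\<theta> \<in> A" "b \<le> \<theta>" for \<theta>
  proof -
    obtain q where q: "q \<in> Q" "F \<theta> = (\<Sum>s\<in>D. q s * u (W \<theta> s))"
      using F_attained \<theta> by blast
    \<comment> \<open>The contribution of state \<open>s\<close> to the slope at \<open>b\<close> of
      the expected utility under \<open>q\<close>.\<close>
    define h where "h s = q s * (deriv u (W b s) * (S s - price))" for s
    have h: "h s \<le> deriv u w0 * \<bar>S s - price\<bar>" if s: "s \<in> D" for s
    proof (cases "price \<le> S s")
      case True
      then have "w0 \<le> W b s" using b by (simp add: wealth_def)
      then have "deriv u (W b s) * (S s - price) \<le> deriv u w0 * \<bar>S s - price\<bar>"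
        using True by (intro mult_mono deriv_antimono w0_in) (auto simp: deriv_pos[OF w0_in] less_imp_le)
      moreover have "h s \<le> 1 * (deriv u (W b s) * (S s - price))"
        unfolding h_def using True deriv_pos[OF wealth_in[OF b_A s]]
        by (intro mult_right_mono weight_le_1 q s) auto
      ultimately show ?thesis by simp
    next
      case False
      then have "h s \<le> 0"
        using weight_pos[OF q(1) s] deriv_pos[OF wealth_in[OF b_A s]]
        by (simp add: h_def mult_nonneg_nonpos)
      then show ?thesis using deriv_pos[OF w0_in] by (smt (verit) mult_nonneg_nonneg)
    qed
    have "sum h D = h t + sum h (D - {t})"
      using finite_D t by (simp add: sum.remove)
    also have "h t = - (q t * (d * deriv u z))"
      by (simp add: h_def d_def W_t algebra_simps)
    also have "\<dots> \<le> - (\<epsilon> * (d * deriv u z))"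
      using weight_ge[OF q(1) t(1)] d deriv_pos[OF z(1)] by (simp add: mult_right_mono)
    also have "\<dots> \<le> - (deriv u w0 * M)"
      using z(3) d \<epsilon>_pos by (simp add: field_simps)
    also have "sum h (D - {t}) \<le> (\<Sum>s\<in>D - {t}. deriv u w0 * \<bar>S s - price\<bar>)"
      by (intro sum_mono h) auto
    also have "\<dots> \<le> (\<Sum>s\<in>D. deriv u w0 * \<bar>S s - price\<bar>)"
      using finite_D deriv_pos[OF w0_in] by (intro sum_mono2) auto
    also have "\<dots> = deriv u w0 * M" by (simp add: M_def sum_distrib_left)
    finally have "sum h D \<le> 0" by simp
    \<comment> \<open>The weight \<open>q\<close> is optimal at \<open>\<theta>\<close> but only
      feasible at \<open>b\<close>, so using it at both demands overestimates the
      difference.\<close>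
    have "F \<theta> - F b \<le> (\<Sum>s\<in>D. q s * u (W \<theta> s)) - (\<Sum>s\<in>D. q s * u (W b s))"
      using F_ge[OF b_A q(1)] q(2) by simp
    also have "\<dots> = (\<Sum>s\<in>D. q s * (u (W \<theta> s) - u (W b s)))"
      by (simp add: right_diff_distrib sum_subtractf)
    also have "\<dots> \<le> (\<Sum>s\<in>D. q s * (deriv u (W b s) * (W \<theta> s - W b s)))"
      using tangent_le wealth_in \<theta> b_A weight_pos[OF q(1)]
      by (intro sum_mono mult_left_mono) (auto simp: less_imp_le diff_le_eq add.commute)
    also have "\<dots> = (\<theta> - b) * sum h D"
      unfolding sum_distrib_left h_def by (intro sum.cong refl) (simp add: wealth_def algebra_simps)
    also have "\<dots> \<le> 0" using \<open>sum h D \<le> 0\<close> \<theta> by (simp add: mult_nonneg_nonpos)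
    finally show ?thesis by simp
  qed
  then show ?thesis using that b b_A by blast
qed

text \<open>A maximum over the compact interval from 0 to \<open>b\<close> exists by continuity. It
  is not at 0, where \<open>F\<close> can be improved, and demands beyond \<open>b\<close> do no
  better than \<open>b\<close>.\<close>

lemma positive_local_maximizer:
  assumes cont: "continuous_on A F"
    and steep: "\<And>K. \<exists>z\<in>I. z < w0 \<and> K < deriv u z"
    and q: "q \<in> Q" "price < (\<Sum>s\<in>D. q s * S s)"
    and t: "t \<in> D" "S t < price"
  shows "\<exists>\<theta>>0. local_maximizer_on A F \<theta>"
proof -
  \<comment> \<open>The state \<open>t\<close> is replaced by one of lowest payoff, as
    \<open>F_eventually_decreasing\<close> requires.\<close>
  obtain t' where t': "t' \<in> D" "\<And>s. s \<in> D \<Longrightarrow> S t' \<le> S s"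
    using ex_is_arg_min_if_finite[of D S] finite_D t by (force simp: is_arg_min_linorder)
  with t have "S t' < price" by fastforce
  with t' steep obtain b where b: "b \<in> A" "0 < b" "\<And>\<theta>. \<theta> \<in> A \<Longrightarrow> b \<le> \<theta> \<Longrightarrow> F \<theta> \<le> F b"
    using F_eventually_decreasing by metis
  obtain \<theta>0 where \<theta>0: "0 < \<theta>0" "\<theta>0 < b" "F 0 < F \<theta>0"
    using F_greater_initial q b by metis
  have sub: "{0..b} \<subseteq> A" using admissible_down[OF b(1)] by auto
  obtain m where m: "m \<in> {0..b}" "\<And>y. y \<in> {0..b} \<Longrightarrow> F y \<le> F m"
    using continuous_attains_sup[OF _ _ continuous_on_subset[OF cont sub]] b by auto
  have "F \<theta>0 \<le> F m" using m \<theta>0 by simp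
  with \<theta>0 have "m \<noteq> 0" by auto
  with m have "0 < m" by auto
  have "F y \<le> F m" if "y \<in> A" "0 \<le> y" for y
    using m b that by (cases "y \<le> b") (auto intro: order_trans[of _ "F b"])
  then have "local_maximizer_on A F m"
    \<comment> \<open>The radius \<open>m\<close> keeps the neighbourhood among the positive
      demands.\<close>
    unfolding local_maximizer_on_def using m sub \<open>0 < m\<close> by (intro conjI exI[of _ m]) auto
  then show ?thesis using \<open>0 < m\<close> by blast
qed

end

section \<open>Chi-square balls of weights\<close>

locale finite_reference =
  fixes D :: "'d set" and p :: "'d \<Rightarrow> real"
  assumes finite_D: "finite D" and p_pos: "s \<in> D \<Longrightarrow> 0 < p s" and p_sum: "sum p D = 1"
begin

definition mean :: "('d \<Rightarrow> real) \<Rightarrow> real" where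
  "mean X = (\<Sum>s\<in>D. p s * X s)"

definition sd :: "('d \<Rightarrow> real) \<Rightarrow> real" where
  "sd X = sqrt (\<Sum>s\<in>D. p s * (X s - mean X)\<^sup>2)"

text \<open>Signed weights are allowed, so that the extremal weights can be written down directly;
  positivity is recovered in \<open>chi2_ball_pos\<close>.\<close>

definition chi2_ball :: "real \<Rightarrow> ('d \<Rightarrow> real) set" where
  "chi2_ball r = {q. sum q D = 1 \<and> (\<Sum>s\<in>D. (q s - p s)\<^sup>2 / p s) \<le> r\<^sup>2}"

lemma sd_nonneg: "0 \<le> sd X"
  by (simp add: sd_def sum_nonneg less_imp_le p_pos)

lemma sd_square: "(sd X)\<^sup>2 = (\<Sum>s\<in>D. p s * (X s - mean X)\<^sup>2)"
  by (simp add: sd_def sum_nonneg less_imp_le p_pos)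

lemma sum_centred: "(\<Sum>s\<in>D. p s * (X s - mean X)) = 0"
  by (simp add: right_diff_distrib sum_subtractf p_sum flip: mean_def sum_distrib_right)

text \<open>Expanding the square shows that, for total mass one, the chi-square distance from
  \<open>p\<close> is the second moment of the density minus 1.\<close>

lemma chi2_ball_iff:
  assumes "1 \<le> c"
  shows "q \<in> chi2_ball (sqrt (c - 1)) \<longleftrightarrow> sum q D = 1 \<and> (\<Sum>s\<in>D. (q s)\<^sup>2 / p s) \<le> c"
proof -
  have "(\<Sum>s\<in>D. (q s - p s)\<^sup>2 / p s) = (\<Sum>s\<in>D. (q s)\<^sup>2 / p s) - 1" if "sum q D = 1"
  proof -
    have "(\<Sum>s\<in>D. (q s - p s)\<^sup>2 / p s) = (\<Sum>s\<in>D. (q s)\<^sup>2 / p s - 2 * q s + p s)"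
      by (intro sum.cong refl) (use p_pos in \<open>force simp: power2_eq_square field_simps\<close>)
    also have "\<dots> = (\<Sum>s\<in>D. (q s)\<^sup>2 / p s) - 1"
      using that p_sum by (simp add: sum.distrib sum_subtractf flip: sum_distrib_left)
    finally show ?thesis .
  qed
  then show ?thesis using assms by (auto simp: chi2_ball_def)
qed

lemma chi2_ball_uminus: "chi2_ball (- r) = chi2_ball r"
  by (simp add: chi2_ball_def)

lemma chi2_ball_mono: "0 \<le> r \<Longrightarrow> r \<le> r' \<Longrightarrow> chi2_ball r \<subseteq> chi2_ball r'"
  unfolding chi2_ball_def using power_mono[of r r' 2] by (auto elim: order_trans)

text \<open>Since \<open>q\<close> and \<open>p\<close> have the same mass, \<open>X\<close> may be
  centred; Cauchy-Schwarz then separates the distance of \<open>q\<close> from the deviation of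
  \<open>X\<close>.\<close>

lemma chi2_ball_bound:
  assumes q: "q \<in> chi2_ball r" and "0 \<le> r"
  shows "\<bar>(\<Sum>s\<in>D. q s * X s) - mean X\<bar> \<le> r * sd X"
proof -
  have "(\<Sum>s\<in>D. q s * X s) - mean X = (\<Sum>s\<in>D. (q s - p s) * (X s - mean X))"
    using q p_sum
    by (simp add: chi2_ball_def mean_def algebra_simps sum.distrib sum_subtractf
        flip: sum_distrib_left sum_distrib_right)
  also have "\<dots> = (\<Sum>s\<in>D. ((q s - p s) / sqrt (p s)) * (sqrt (p s) * (X s - mean X)))"
    by (intro sum.cong refl) (use p_pos in force)
  finally have "((\<Sum>s\<in>D. q s * X s) - mean X)\<^sup>2 \<le>
      (\<Sum>s\<in>D. ((q s - p s) / sqrt (p s))\<^sup>2) * (\<Sum>s\<in>D. (sqrt (p s) * (X s - mean X))\<^sup>2)"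
    using Cauchy_Schwarz_ineq_sum by metis
  also have "\<dots> = (\<Sum>s\<in>D. (q s - p s)\<^sup>2 / p s) * (\<Sum>s\<in>D. p s * (X s - mean X)\<^sup>2)"
    by (intro arg_cong2[where f = "(*)"] sum.cong refl)
      (use p_pos in \<open>auto simp: power_divide power_mult_distrib less_imp_le\<close>)
  also have "\<dots> \<le> r\<^sup>2 * (sd X)\<^sup>2"
    unfolding sd_square[symmetric] using q by (intro mult_right_mono) (auto simp: chi2_ball_def)
  finally show ?thesis
    using abs_le_square_iff[of "(\<Sum>s\<in>D. q s * X s) - mean X" "r * sd X"] assms(2) sd_nonneg[of X]
    by (simp add: power_mult_distrib)
qed

text \<open>The equality case of Cauchy-Schwarz, where \<open>q - p\<close> is proportional to
  \<open>p\<close> times the centred \<open>X\<close>. The sign of \<open>r\<close> is free: a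
  negative one yields the minimum. If \<open>sd X = 0\<close>, then \<open>p\<close> itself
  serves.\<close>

lemma chi2_ball_attains:
  "\<exists>q\<in>chi2_ball r. (\<Sum>s\<in>D. q s * X s) = mean X + r * sd X"
proof (cases "sd X = 0")
  case True
  then show ?thesis
    by (intro bexI[of _ p]) (auto simp: chi2_ball_def mean_def p_sum)
next
  case False
  define q where "q = (\<lambda>s. p s + r / sd X * (p s * (X s - mean X)))"
  have "sum q D = 1"
    unfolding q_def sum.distrib sum_distrib_left[symmetric] sum_centred by (simp add: p_sum)
  moreover have "(\<Sum>s\<in>D. (q s - p s)\<^sup>2 / p s) = (\<Sum>s\<in>D. (r / sd X)\<^sup>2 * (p s * (X s - mean X)\<^sup>2))"
    by (intro sum.cong refl) (use p_pos in \<open>force simp: q_def power2_eq_square\<close>)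
  then have "(\<Sum>s\<in>D. (q s - p s)\<^sup>2 / p s) = r\<^sup>2"
    using False by (simp only: sum_distrib_left[symmetric] sd_square[symmetric]) (simp add: power_divide)
  ultimately have "q \<in> chi2_ball r" by (simp add: chi2_ball_def)
  moreover have "(\<Sum>s\<in>D. p s * (X s - mean X) * X s) = (sd X)\<^sup>2"
  proof -
    have "(\<Sum>s\<in>D. p s * (X s - mean X) * X s) =
        (\<Sum>s\<in>D. p s * (X s - mean X)\<^sup>2) + mean X * (\<Sum>s\<in>D. p s * (X s - mean X))"
      unfolding sum_distrib_left sum.distrib[symmetric]
      by (intro sum.cong refl) (simp add: power2_eq_square algebra_simps)
    then show ?thesis by (simp add: sum_centred sd_square)
  qed
  then have "(\<Sum>s\<in>D. r / sd X * (p s * (X s - mean X)) * X s) = r * sd X"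
    using False by (simp only: mult.assoc sum_distrib_left[symmetric]) (simp add: power2_eq_square)
  then have "(\<Sum>s\<in>D. q s * X s) = mean X + r * sd X"
    by (simp add: q_def distrib_right sum.distrib mean_def)
  ultimately show ?thesis by blast
qed

lemma sd_indicator:
  assumes "t \<in> D"
  shows "sd (indicator {t}) = sqrt (p t * (1 - p t))"
proof -
  have m: "mean (indicator {t}) = p t"
    using assms finite_D by (simp add: mean_def indicator_def if_distrib cong: if_cong)
  have "(\<Sum>s\<in>D. p s * (indicator {t} s - p t)\<^sup>2) =
      (\<Sum>s\<in>D. (1 - 2 * p t) * (p s * indicator {t} s) + (p t)\<^sup>2 * p s)"
    by (intro sum.cong refl) (auto simp: indicator_def power2_eq_square algebra_simps)
  also have "\<dots> = (1 - 2 * p t) * p t + (p t)\<^sup>2"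
    using m by (simp add: sum.distrib p_sum mean_def flip: sum_distrib_left)
  also have "\<dots> = p t * (1 - p t)"
    by (simp add: power2_eq_square algebra_simps)
  finally show ?thesis by (simp add: sd_def m)
qed

text \<open>The bound \<open>chi2_ball_bound\<close> for the indicator of \<open>s\<close> gives
  \<open>g s \<le> q s\<close>. Positivity of \<open>g s\<close> amounts to
  \<open>(c - 1) * (1 - p s) < p s\<close>, which is the assumed bound on \<open>c\<close>.\<close>

lemma chi2_ball_pos:
  assumes "1 \<le> c" "\<And>s. s \<in> D \<Longrightarrow> p s < 1" "\<And>s. s \<in> D \<Longrightarrow> c < 1 / (1 - p s)"
  obtains \<epsilon> where "0 < \<epsilon>" "\<And>q s. q \<in> chi2_ball (sqrt (c - 1)) \<Longrightarrow> s \<in> D \<Longrightarrow> \<epsilon> \<le> q s"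
proof -
  define g where "g s = p s - sqrt (c - 1) * sqrt (p s * (1 - p s))" for s
  define \<epsilon> where "\<epsilon> = Min (g ` D)"
  have "D \<noteq> {}" using p_sum by auto
  have "0 < g s" if "s \<in> D" for s
  proof -
    have p: "0 < p s" "p s < 1" "c < 1 / (1 - p s)" using that assms p_pos by auto
    have "(c - 1) * (1 - p s) < p s" using p by (simp add: field_simps)
    then have "((c - 1) * (1 - p s)) * p s < p s * p s"
      using p(1) by (rule mult_strict_right_mono)
    then have "sqrt ((c - 1) * (p s * (1 - p s))) < sqrt ((p s)\<^sup>2)"
      by (intro real_sqrt_less_mono) (simp add: power2_eq_square mult_ac)
    then show ?thesis using p by (simp add: g_def real_sqrt_mult)
  qed
  then have "0 < \<epsilon>" using finite_D \<open>D \<noteq> {}\<close> by (simp add: \<epsilon>_def)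
  moreover have "\<epsilon> \<le> q s" if "q \<in> chi2_ball (sqrt (c - 1))" "s \<in> D" for q s
  proof -
    have "(\<Sum>t\<in>D. q t * indicator {s} t) = q s" "mean (indicator {s}) = p s"
      using that finite_D by (simp_all add: mean_def indicator_def if_distrib cong: if_cong)
    then have "\<bar>q s - p s\<bar> \<le> sqrt (c - 1) * sqrt (p s * (1 - p s))"
      using chi2_ball_bound[OF that(1), of "indicator {s}"] sd_indicator[OF that(2)] assms(1) by simp
    then have "g s \<le> q s" by (simp add: g_def)
    moreover have "\<epsilon> \<le> g s" using finite_D that by (simp add: \<epsilon>_def)
    ultimately show ?thesis by simp
  qed
  ultimately show ?thesis using that by blast
qed

end

section \<open>The alpha-maxmin market\<close>

lemma local_maximizer_on_uminus:
  assumes "local_maximizer_on A f x" "\<And>y. y \<in> A \<longleftrightarrow> - y \<in> B" "\<And>y. f y = g (- y)"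
  shows "local_maximizer_on B g (- x)"
proof -
  obtain \<eta> where x: "x \<in> A" "0 < \<eta>" and max: "\<And>y. y \<in> A \<Longrightarrow> \<bar>y - x\<bar> < \<eta> \<Longrightarrow> f y \<le> f x"
    using assms(1) unfolding local_maximizer_on_def by blast
  have "g y \<le> g (- x)" if "y \<in> B" "\<bar>y - - x\<bar> < \<eta>" for y
    using max[of "- y"] that assms(2)[of "- y"] assms(3)[of "- y"] assms(3)[of x] by simp
  then show ?thesis
    unfolding local_maximizer_on_def using x assms(2)[of x] by blast
qed

locale chi2_ambiguity =
  fixes D :: "'d set" and P0 :: "'d pmf" and c \<alpha> :: real
  assumes finite_states: "finite D" and two_states: "2 \<le> card D" and support: "set_pmf P0 = D"
    and c_ge_1: "1 \<le> c" and c_less: "c < Min ((\<lambda>s. 1 / (1 - pmf P0 s)) ` D)"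
    and \<alpha>_nonneg: "0 \<le> \<alpha>" and \<alpha>_less: "\<alpha> < 1 / 2"
begin

sublocale finite_reference D "pmf P0"
  using finite_states support by unfold_locales (auto intro: pmf_positive sum_pmf_eq_1)

lemma expectation_eq_sum: "set_pmf P \<subseteq> D \<Longrightarrow> measure_pmf.expectation P X = (\<Sum>s\<in>D. pmf P s * X s)"
  using finite_states by (subst integral_measure_pmf[of D]) auto

lemma expectation_eq_mean: "measure_pmf.expectation P0 X = mean X"
  using support by (simp add: expectation_eq_sum mean_def)

lemma std_dev_eq_sd: "std_dev P0 X = sd X"
  using support by (simp add: std_dev_def sd_def expectation_eq_mean) (simp add: mean_def)

text \<open>A second state carries positive mass. Hence \<open>1 / (1 - pmf P0 s)\<close> is a
  genuine quotient and not the default value 0 of division by zero.\<close>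

lemma pmf_less_1:
  assumes "s \<in> D"
  shows "pmf P0 s < 1"
proof -
  have "card (D - {s}) \<noteq> 0"
    using two_states assms by simp
  then have "D - {s} \<noteq> {}"
    by force
  then have "0 < sum (pmf P0) (D - {s})"
    using finite_states p_pos by (intro sum_pos) auto
  then show ?thesis
    using p_sum sum.remove[OF finite_states assms, of "pmf P0"] by simp
qed

lemma weights_bounded_below:
  obtains \<epsilon> where "0 < \<epsilon>" "\<And>q s. q \<in> chi2_ball (sqrt (c - 1)) \<Longrightarrow> s \<in> D \<Longrightarrow> \<epsilon> \<le> q s"
proof (rule chi2_ball_pos[OF c_ge_1 pmf_less_1])
  show "c < 1 / (1 - pmf P0 s)" if "s \<in> D" for s
    using c_less finite_states that by (subst (asm) Min_gr_iff) auto
qed auto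

text \<open>Every weight in the ball is positive on \<open>D\<close>, so it is a mass function
  there, and the sign constraint on priors cuts nothing off.\<close>

lemma expectation_image_priors:
  "(\<lambda>P. measure_pmf.expectation P X) ` priors D P0 c =
    (\<lambda>q. \<Sum>s\<in>D. q s * X s) ` chi2_ball (sqrt (c - 1))" (is "?L = ?R")
proof
  show "?L \<subseteq> ?R"
  proof (rule image_subsetI)
    fix P assume P: "P \<in> priors D P0 c"
    then have "pmf P \<in> chi2_ball (sqrt (c - 1))"
      using chi2_ball_iff[OF c_ge_1] finite_states by (simp add: priors_def sum_pmf_eq_1)
    then show "measure_pmf.expectation P X \<in> ?R"
      using P by (auto simp: expectation_eq_sum priors_def)
  qed
  show "?R \<subseteq> ?L"
  proof (rule image_subsetI)
    fix q assume q: "q \<in> chi2_ball (sqrt (c - 1))"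
    \<comment> \<open>The ball leaves values outside \<open>D\<close> arbitrary; a mass function
      supported in \<open>D\<close> must vanish there.\<close>
    define f where "f s = (if s \<in> D then q s else 0)" for s
    obtain \<epsilon> where \<epsilon>: "0 < \<epsilon>" "\<And>s. s \<in> D \<Longrightarrow> \<epsilon> \<le> q s"
      using weights_bounded_below q by metis
    then have f_nonneg: "0 \<le> f s" for s
      by (auto simp: f_def intro: order_trans[of 0 \<epsilon>])
    have "(\<integral>\<^sup>+s. ennreal (f s) \<partial>count_space UNIV) = (\<Sum>s\<in>D. ennreal (f s))"
      using finite_states by (intro nn_integral_count_space') (auto simp: f_def)
    also have "\<dots> = ennreal (sum q D)"
    proof -
      have "sum f D = sum q D" by (intro sum.cong) (auto simp: f_def)
      then show ?thesis using f_nonneg by (simp add: sum_ennreal)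
    qed
    finally have "(\<integral>\<^sup>+s. ennreal (f s) \<partial>count_space UNIV) = 1"
      using q by (simp add: chi2_ball_def)
    then have pmf: "pmf (embed_pmf f) = f" and supp: "set_pmf (embed_pmf f) \<subseteq> D"
      using pmf_embed_pmf[of f, OF f_nonneg] set_embed_pmf[of f, OF f_nonneg]
      by (auto simp: fun_eq_iff) (auto simp: f_def split: if_splits)
    have "embed_pmf f \<in> priors D P0 c"
      using q chi2_ball_iff[OF c_ge_1] supp by (simp add: priors_def pmf f_def)
    moreover have "measure_pmf.expectation (embed_pmf f) X = (\<Sum>s\<in>D. q s * X s)"
      using expectation_eq_sum[OF supp] by (simp add: pmf f_def)
    ultimately show "(\<Sum>s\<in>D. q s * X s) \<in> ?L"
      by (intro image_eqI[of _ _ "embed_pmf f"]) simp_all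
  qed
qed

text \<open>Minimum and maximum are \<open>mean X - r * sd X\<close> and
  \<open>mean X + r * sd X\<close>; mixing them leaves \<open>r * (1 - 2 * \<alpha>)\<close> in
  front of \<open>sd X\<close>, and this is \<open>\<bar>delta c \<alpha>\<bar>\<close> because
  \<open>\<alpha> < 1 / 2\<close>.\<close>

lemma V_eq:
  "V D P0 c u w0 price S \<alpha> \<theta> =
    mean (\<lambda>s. u (wealth w0 price S \<theta> s)) + \<bar>delta c \<alpha>\<bar> * sd (\<lambda>s. u (wealth w0 price S \<theta> s))"
proof -
  define X where "X s = u (wealth w0 price S \<theta> s)" for s
  define r where "r = sqrt (c - 1)"
  have r: "0 \<le> r" using c_ge_1 by (simp add: r_def)
  have E: "expected_utility u w0 price S \<theta> ` priors D P0 c = (\<lambda>q. \<Sum>s\<in>D. q s * X s) ` chi2_ball r"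
    using expectation_image_priors[of X] by (simp add: expected_utility_def[abs_def] X_def[abs_def] r_def)
  have least: "(LEAST v. v \<in> (\<lambda>q. \<Sum>s\<in>D. q s * X s) ` chi2_ball r) = mean X - r * sd X"
  proof (rule Least_equality)
    show "mean X - r * sd X \<in> (\<lambda>q. \<Sum>s\<in>D. q s * X s) ` chi2_ball r"
      using chi2_ball_attains[of "- r" X] by (force simp: chi2_ball_uminus)
    show "mean X - r * sd X \<le> v" if "v \<in> (\<lambda>q. \<Sum>s\<in>D. q s * X s) ` chi2_ball r" for v
      using that chi2_ball_bound[OF _ r, of _ X] by fastforce
  qed
  have greatest: "(GREATEST v. v \<in> (\<lambda>q. \<Sum>s\<in>D. q s * X s) ` chi2_ball r) = mean X + r * sd X"
  proof (rule Greatest_equality)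
    show "mean X + r * sd X \<in> (\<lambda>q. \<Sum>s\<in>D. q s * X s) ` chi2_ball r"
      using chi2_ball_attains[of r X] by force
    show "v \<le> mean X + r * sd X" if "v \<in> (\<lambda>q. \<Sum>s\<in>D. q s * X s) ` chi2_ball r" for v
      using that chi2_ball_bound[OF _ r, of _ X] by fastforce
  qed
  have k: "\<bar>delta c \<alpha>\<bar> = r * (1 - 2 * \<alpha>)"
    using r \<alpha>_less by (simp add: delta_def r_def abs_mult)
  have "V D P0 c u w0 price S \<alpha> \<theta> = mean X + \<bar>delta c \<alpha>\<bar> * sd X"
    unfolding V_def E least greatest k by (simp add: algebra_simps)
  then show ?thesis by (simp add: X_def[abs_def])
qed

lemma ball_delta_subset: "chi2_ball \<bar>delta c \<alpha>\<bar> \<subseteq> chi2_ball (sqrt (c - 1))"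
proof (rule chi2_ball_mono)
  show "\<bar>delta c \<alpha>\<bar> \<le> sqrt (c - 1)"
    using c_ge_1 \<alpha>_nonneg \<alpha>_less by (simp add: delta_def abs_mult mult_left_le)
qed simp

lemma upper_price_eq: "upper_price P0 c \<alpha> S = mean S + \<bar>delta c \<alpha>\<bar> * sd S"
  and lower_price_eq: "lower_price P0 c \<alpha> S = mean S - \<bar>delta c \<alpha>\<bar> * sd S"
  by (simp_all add: upper_price_def lower_price_def expectation_eq_mean std_dev_eq_sd)

end

text \<open>The assumption \<open>steep\<close> is the common form in which both Inada cases enter:
  arbitrarily large marginal utility at some wealth below \<open>w0\<close>.\<close>

locale ambiguous_market = chi2_ambiguity D P0 c \<alpha> + utility_function I u
  for D :: "'d set" and P0 :: "'d pmf" and c \<alpha> :: real and I :: "real set" and u :: "real \<Rightarrow> real" +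
  fixes w0 :: real
  assumes w0_in_I: "w0 \<in> I"
    and steep: "\<And>K. \<exists>z\<in>I. z < w0 \<and> K < deriv u z"
begin

text \<open>Since \<open>\<alpha> < 1 / 2\<close>, the weighted sum of minimum and maximum is itself a maximum of
  expectations, over the smaller ball of radius \<open>\<bar>\<delta>\<bar>\<close>.\<close>

lemma robust_demand_V:
  obtains \<epsilon> where
    "robust_demand I u D (chi2_ball \<bar>delta c \<alpha>\<bar>) S \<epsilon> price w0 (V D P0 c u w0 price S \<alpha>)"
proof -
  obtain \<epsilon> where \<epsilon>: "0 < \<epsilon>" "\<And>q s. q \<in> chi2_ball (sqrt (c - 1)) \<Longrightarrow> s \<in> D \<Longrightarrow> \<epsilon> \<le> q s"
    using weights_bounded_below by blast
  have "robust_demand I u D (chi2_ball \<bar>delta c \<alpha>\<bar>) S \<epsilon> price w0 (V D P0 c u w0 price S \<alpha>)"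
  proof unfold_locales
    fix q s assume "q \<in> chi2_ball \<bar>delta c \<alpha>\<bar>" "s \<in> D"
    then show "\<epsilon> \<le> q s" using \<epsilon> ball_delta_subset by blast
  next
    fix q assume "q \<in> chi2_ball \<bar>delta c \<alpha>\<bar>"
    then show "sum q D = 1" by (simp add: chi2_ball_def)
  next
    fix \<theta> q assume "q \<in> chi2_ball \<bar>delta c \<alpha>\<bar>"
    then show "(\<Sum>s\<in>D. q s * u (wealth w0 price S \<theta> s)) \<le> V D P0 c u w0 price S \<alpha> \<theta>"
      using chi2_ball_bound[of q "\<bar>delta c \<alpha>\<bar>" "\<lambda>s. u (wealth w0 price S \<theta> s)"] by (simp add: V_eq)
  next
    fix \<theta>
    show "\<exists>q\<in>chi2_ball \<bar>delta c \<alpha>\<bar>.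
        V D P0 c u w0 price S \<alpha> \<theta> = (\<Sum>s\<in>D. q s * u (wealth w0 price S \<theta> s))"
      using chi2_ball_attains[of "\<bar>delta c \<alpha>\<bar>" "\<lambda>s. u (wealth w0 price S \<theta> s)"] by (simp add: V_eq) metis
  qed (fact finite_states \<epsilon>(1) w0_in_I)+
  then show ?thesis using that by blast
qed

lemma continuous_on_V:
  "continuous_on (admissible D I w0 price S) (V D P0 c u w0 price S \<alpha>)"
proof -
  have "continuous_on (admissible D I w0 price S) (\<lambda>\<theta>. u (wealth w0 price S \<theta> s))" if "s \<in> D" for s
    using that unfolding wealth_def
    by (intro continuous_on_compose2[OF continuous_on_u] continuous_intros)
      (auto simp: admissible_def wealth_def)
  then show ?thesis
    unfolding V_eq mean_def sd_def by (intro continuous_intros)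
qed

text \<open>The upper price is the largest mean of \<open>S\<close> over the ball of radius
  \<open>\<bar>delta c \<alpha>\<bar>\<close>, so no weight there gives a positive mean excess
  payoff.\<close>

lemma no_positive_demand:
  assumes "upper_price P0 c \<alpha> S \<le> price" and "\<exists>s\<in>D. \<exists>t\<in>D. S s \<noteq> S t"
  shows "{\<theta>. is_arg_max (V D P0 c u w0 price S \<alpha>)
    (\<lambda>\<theta>. \<theta> \<in> admissible D I w0 price S \<and> 0 \<le> \<theta>) \<theta>} = {0}"
proof -
  obtain \<epsilon> where "robust_demand I u D (chi2_ball \<bar>delta c \<alpha>\<bar>) S \<epsilon> price w0 (V D P0 c u w0 price S \<alpha>)"
    using robust_demand_V .
  then interpret R: robust_demand I u D "chi2_ball \<bar>delta c \<alpha>\<bar>" S \<epsilon> price w0 "V D P0 c u w0 price S \<alpha>" .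
  have "(\<Sum>s\<in>D. q s * S s) \<le> price" if "q \<in> chi2_ball \<bar>delta c \<alpha>\<bar>" for q
    using chi2_ball_bound[OF that, of S] assms(1) by (simp add: upper_price_eq)
  moreover obtain t where "t \<in> D" "S t \<noteq> price" using assms(2) by metis
  ultimately have "V D P0 c u w0 price S \<alpha> \<theta> < V D P0 c u w0 price S \<alpha> 0"
    if "\<theta> \<in> R.A" "0 \<le> \<theta>" "\<theta> \<noteq> 0" for \<theta>
    using R.F_less_initial that by simp
  then show ?thesis
    using R.zero_admissible by (force simp: is_arg_max_def not_less_iff_gr_or_eq)
qed

text \<open>The two bounds are the extreme means of \<open>S\<close> over the ball. The weight
  \<open>q\<close> for the upper one makes buying attractive at 0; the weight \<open>q'\<close> for
  the lower one forces some payoff below the price, so that large purchases are risky.\<close>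

lemma positive_demand:
  assumes "lower_price P0 c \<alpha> S < price" "price < upper_price P0 c \<alpha> S"
  shows "\<exists>\<theta>>0. local_maximizer_on (admissible D I w0 price S) (V D P0 c u w0 price S \<alpha>) \<theta>"
proof -
  obtain \<epsilon> where "robust_demand I u D (chi2_ball \<bar>delta c \<alpha>\<bar>) S \<epsilon> price w0 (V D P0 c u w0 price S \<alpha>)"
    using robust_demand_V .
  then interpret R: robust_demand I u D "chi2_ball \<bar>delta c \<alpha>\<bar>" S \<epsilon> price w0 "V D P0 c u w0 price S \<alpha>" .
  obtain q where q: "q \<in> chi2_ball \<bar>delta c \<alpha>\<bar>" "(\<Sum>s\<in>D. q s * S s) = upper_price P0 c \<alpha> S"
    using chi2_ball_attains[of "\<bar>delta c \<alpha>\<bar>" S] by (auto simp: upper_price_eq)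
  obtain q' where q': "q' \<in> chi2_ball \<bar>delta c \<alpha>\<bar>" "(\<Sum>s\<in>D. q' s * S s) = lower_price P0 c \<alpha> S"
    using chi2_ball_attains[of "- \<bar>delta c \<alpha>\<bar>" S] by (auto simp: lower_price_eq chi2_ball_uminus)
  have "\<exists>t\<in>D. S t < price"
  proof (rule ccontr)
    assume "\<not> ?thesis"
    then have "(\<Sum>s\<in>D. q' s * price) \<le> (\<Sum>s\<in>D. q' s * S s)"
      using R.weight_pos[OF q'(1)] by (intro sum_mono mult_left_mono) (auto simp: not_less less_imp_le)
    then show False
      using q' R.weight_sum[OF q'(1)] assms by (simp flip: sum_distrib_right)
  qed
  then show ?thesis
    using R.positive_local_maximizer[OF continuous_on_V steep q(1)] q(2) assms by auto
qed

section \<open>Reflection: short positions as long positions in the negated asset\<close>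

lemma wealth_uminus: "wealth w0 (- price) (\<lambda>s. - S s) \<theta> = wealth w0 price S (- \<theta>)"
  by (simp add: wealth_def fun_eq_iff algebra_simps)

lemma admissible_uminus:
  "\<theta> \<in> admissible D I w0 (- price) (\<lambda>s. - S s) \<longleftrightarrow> - \<theta> \<in> admissible D I w0 price S"
  by (simp add: admissible_def wealth_uminus)

lemma V_uminus: "V D P0 c u w0 (- price) (\<lambda>s. - S s) \<alpha> \<theta> = V D P0 c u w0 price S \<alpha> (- \<theta>)"
  by (simp add: V_eq wealth_uminus)

lemma mean_uminus: "mean (\<lambda>s. - X s) = - mean X"
  by (simp add: mean_def sum_negf)

lemma sd_uminus: "sd (\<lambda>s. - X s) = sd X"
  by (simp add: sd_def mean_uminus power2_commute[of "mean X"])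

text \<open>Negation reverses the mean and preserves the deviation, so the two price bounds swap
  roles.\<close>

lemma upper_price_uminus: "upper_price P0 c \<alpha> (\<lambda>s. - S s) = - lower_price P0 c \<alpha> S"
  and lower_price_uminus: "lower_price P0 c \<alpha> (\<lambda>s. - S s) = - upper_price P0 c \<alpha> S"
  by (simp_all add: upper_price_eq lower_price_eq mean_uminus sd_uminus)

lemma no_negative_demand:
  assumes "price \<le> lower_price P0 c \<alpha> S" and "\<exists>s\<in>D. \<exists>t\<in>D. S s \<noteq> S t"
  shows "{\<theta>. is_arg_max (V D P0 c u w0 price S \<alpha>)
    (\<lambda>\<theta>. \<theta> \<in> admissible D I w0 price S \<and> \<theta> \<le> 0) \<theta>} = {0}" (is "?M = _")
proof -
  have "{\<theta>. - \<theta> \<in> ?M} = {0}"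
  proof -
    have "is_arg_max (V D P0 c u w0 (- price) (\<lambda>s. - S s) \<alpha>)
        (\<lambda>\<theta>. \<theta> \<in> admissible D I w0 (- price) (\<lambda>s. - S s) \<and> 0 \<le> \<theta>) \<theta> \<longleftrightarrow> - \<theta> \<in> ?M" for \<theta>
      unfolding is_arg_max_def V_uminus admissible_uminus mem_Collect_eq
      by (metis neg_0_le_iff_le neg_le_0_iff_le minus_minus)
    then show ?thesis
      using no_positive_demand[of "\<lambda>s. - S s" "- price"] assms by (simp add: upper_price_uminus)
  qed
  then show ?thesis
    by (simp add: set_eq_iff) (metis minus_minus neg_equal_0_iff_equal)
qed

lemma negative_demand:
  assumes "lower_price P0 c \<alpha> S < price" "price < upper_price P0 c \<alpha> S"
  shows "\<exists>\<theta><0. local_maximizer_on (admissible D I w0 price S) (V D P0 c u w0 price S \<alpha>) \<theta>"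
proof -
  obtain \<theta> where "0 < \<theta>"
    and max: "local_maximizer_on (admissible D I w0 (- price) (\<lambda>s. - S s))
      (V D P0 c u w0 (- price) (\<lambda>s. - S s) \<alpha>) \<theta>"
    using positive_demand[of "\<lambda>s. - S s" "- price"] assms
    by (auto simp: upper_price_uminus lower_price_uminus)
  from max have "local_maximizer_on (admissible D I w0 price S) (V D P0 c u w0 price S \<alpha>) (- \<theta>)"
    by (rule local_maximizer_on_uminus) (simp_all add: admissible_uminus V_uminus)
  with \<open>0 < \<theta>\<close> show ?thesis
    by (intro exI[of _ "- \<theta>"]) simp
qed

end

text \<open>Marginal utility is unbounded at the lower end of \<open>I\<close>, and points near that
  end can also be taken below \<open>w0\<close>.\<close>

lemma inada_steep:
  assumes "I = UNIV \<and> inada_real_line u \<or> I = {0<..} \<and> w0 > 0 \<and> inada_positive u"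
  shows "\<exists>z\<in>I. z < w0 \<and> K < deriv u z"
  using assms
proof (elim disjE conjE)
  assume I: "I = UNIV" and "inada_real_line u"
  then have "\<forall>\<^sub>F z in at_bot. K < deriv u z"
    by (simp add: inada_real_line_def filterlim_at_top_dense)
  then obtain z where "\<And>x. x \<le> z \<Longrightarrow> K < deriv u x"
    unfolding eventually_at_bot_linorder by blast
  then show ?thesis
    using I by (intro bexI[of _ "min z (w0 - 1)"]) auto
next
  assume I: "I = {0<..}" "w0 > 0" and "inada_positive u"
  then have "\<forall>\<^sub>F z in at_right 0. K < deriv u z"
    by (simp add: inada_positive_def filterlim_at_top_dense)
  then obtain b where "0 < b" "\<And>x. 0 < x \<Longrightarrow> x < b \<Longrightarrow> K < deriv u x"
    unfolding eventually_at_right_field by blast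
  then show ?thesis
    using I by (intro bexI[of _ "min b w0 / 2"]) auto
qed

theorem proposition2p10:
  fixes D :: "'d set" and P0 :: "'d pmf" and S :: "'d \<Rightarrow> real"
    and u :: "real \<Rightarrow> real" and I :: "real set"
    and c \<alpha> w0 price :: real
  assumes "finite D" and "card D \<ge> 2"
    and "set_pmf P0 = D"
    and "c \<ge> 1" and "c < Min ((\<lambda>s. 1 / (1 - pmf P0 s)) ` D)"
    and "\<exists>s\<in>D. \<exists>t\<in>D. S s \<noteq> S t"
    and "0 \<le> \<alpha>" and "\<alpha> < 1 / 2"
    and "(I = UNIV \<and> inada_real_line u) \<or> (I = {0<..} \<and> w0 > 0 \<and> inada_positive u)"
    and "strict_mono_on I u" and "strictly_concave_on I u" and "twice_differentiable_on u I"
  shows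
    "(price \<ge> upper_price P0 c \<alpha> S \<longrightarrow>
        {\<theta>. is_arg_max (V D P0 c u w0 price S \<alpha>)
              (\<lambda>\<theta>. \<theta> \<in> admissible D I w0 price S \<and> \<theta> \<ge> 0) \<theta>} = {0})
     \<and> (price \<le> lower_price P0 c \<alpha> S \<longrightarrow>
        {\<theta>. is_arg_max (V D P0 c u w0 price S \<alpha>)
              (\<lambda>\<theta>. \<theta> \<in> admissible D I w0 price S \<and> \<theta> \<le> 0) \<theta>} = {0})
     \<and> (price \<in> {measure_pmf.expectation P0 S..<upper_price P0 c \<alpha> S} \<longrightarrow>
        (\<exists>\<theta><0. local_maximizer_on (admissible D I w0 price S) (V D P0 c u w0 price S \<alpha>) \<theta>)
        \<and> (\<exists>\<theta>>0. local_maximizer_on (admissible D I w0 price S) (V D P0 c u w0 price S \<alpha>) \<theta>))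
     \<and> (price \<in> {lower_price P0 c \<alpha> S<..measure_pmf.expectation P0 S} \<longrightarrow>
        (\<exists>\<theta>>0. local_maximizer_on (admissible D I w0 price S) (V D P0 c u w0 price S \<alpha>) \<theta>)
        \<and> (\<exists>\<theta><0. local_maximizer_on (admissible D I w0 price S) (V D P0 c u w0 price S \<alpha>) \<theta>))"
proof -
  interpret ambiguous_market D P0 c \<alpha> I u w0
  proof unfold_locales
    show "open I" "w0 \<in> I" "\<And>x y. x \<in> I \<Longrightarrow> x \<le> y \<Longrightarrow> y \<in> I"
      using assms(9) by auto
    show "u differentiable_on I"
      using assms(12) by (simp add: twice_differentiable_on_def)
    show "\<exists>z\<in>I. z < w0 \<and> K < deriv u z" for K
      using inada_steep[OF assms(9)] .
  qed (use assms in auto)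
  have "lower_price P0 c \<alpha> S \<le> mean S" "mean S \<le> upper_price P0 c \<alpha> S"
    by (simp_all add: lower_price_eq upper_price_eq sd_nonneg)
  \<comment> \<open>Both bounds are equally far from the mean. If that distance is 0, both half-open
    price ranges are empty; otherwise each of them, including its endpoint \<open>mean S\<close>,
    lies strictly between the bounds.\<close>
  moreover have "lower_price P0 c \<alpha> S < mean S \<longleftrightarrow> mean S < upper_price P0 c \<alpha> S"
    by (simp add: lower_price_eq upper_price_eq)
  ultimately show ?thesis
    using no_positive_demand[OF _ assms(6)] no_negative_demand[OF _ assms(6)]
      positive_demand[of S price] negative_demand[of S price]
    by (auto simp: expectation_eq_mean)
qed

end
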